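(* Let $n\ge1$, let $0=b_0<b_1<\cdots<b_n<b_{n+1}=1$, and let $r\in L^\infty(I)$, $I=(0,1)$, be bounded below a.e. on $I$ by a constant $r_0\ge 0$. The mass matrix $M_r(\mathbf b)$ has the factorization $$M_r(\mathbf b)=T_1^{-1}\,T_2\,T_3^{-1},$$ where $T_1$, $T_2$ and $T_3$ are tri-diagonal matrices, given in either of the following two ways. (1) $T_1=M^1(\mathbf b)^{-1}$, $T_2=M^2(\mathbf b)^{-1}+M^1(\mathbf b)^{-1}$, $T_3=M^2(\mathbf b)^{-1}$; that is, $$M_r(\mathbf b)^{-1}=M^2(\mathbf b)^{-1}\left(M^2(\mathbf b)^{-1}+M^1(\mathbf b)^{-1}\right)^{-1}M^1(\mathbf b)^{-1}.$$ (2) $T_1=Q^T$, $T_2=T_{M_r}$, $T_3=Q$; that is, $$M_r(\mathbf b)=Q^{-T}\,T_{M_r}\,Q^{-1},$$ where $Q=G\,\mathbf D(\mathbf h)^{-1}G$ and $$T_{M_r}=(I-G^T)\mathbf D_{00}(r)(I-G)+(I-G^T)\mathbf D_{01}(r)G+G^T\mathbf D_{10}(r)(I-G)+G^T\mathbf D_{11}(r)G .$$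
   Context: $\sigma(t)=\max\{0,t\}$; $\mathbf b=(b_1,\dots,b_n)^T$; $h_i=b_{i+1}-b_i$, $i=0,\dots,n$. The mass matrix is $M_r(\mathbf b)=(m_{ij})_{i,j=1}^{n+1}$ with $m_{ij}=\int_0^1 r(x)\sigma(x-b_{i-1})\sigma(x-b_{j-1})\,dx$. Matrices in (1): $M^1(\mathbf b)=(m^1_{ij})_{i,j=1}^{n+1}$ and $M^2(\mathbf b)=(m^2_{ij})_{i,j=1}^{n+1}$ with $m^1_{ij}=\beta^1_{\max\{i,j\}}$ and $m^2_{ij}=\alpha^2_{\min\{i,j\}}\beta^2_{\max\{i,j\}}$, where (superscripts are indices) $\beta^1_k=\int_{b_{k-1}}^1 r(x)(x-1)(x-b_{k-1})\,dx$, $\alpha^2_k=1-b_{k-1}$, $\beta^2_k=\int_{b_{k-1}}^1 r(x)(x-b_{k-1})\,dx$ for $k=1,\dots,n+1$. One has $M_r(\mathbf b)=M^1(\mathbf b)+M^2(\mathbf b)$. Matrices in (2), all of size $(n+1)\times(n+1)$: $I$ (in matrix expressions) is the identity matrix; $G$ is the lower bidiagonal matrix with $1$ on the diagonal, $-1$ on the first subdiagonal and $0$ elsewhere; $\mathbf D(\mathbf h)=\mathrm{diag}(h_0,\dots,h_n)$; for $k=0,1,2$, $\mathbf D_r(\mathbf s^k)=\mathrm{diag}(s_0^k(r),\dots,s_n^k(r))$ with $s_i^k(r)=\int_{b_i}^{b_{i+1}}r(x)(x-b_i)^k\,dx$; and $\mathbf D_{00}(r)=\mathbf D_r(\mathbf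 s^0)$, $\mathbf D_{01}(r)=\mathbf D_{10}(r)=\mathbf D(\mathbf h)^{-1}\mathbf D_r(\mathbf s^1)$, $\mathbf D_{11}(r)=\mathbf D(\mathbf h)^{-2}\mathbf D_r(\mathbf s^2)$. $Q^{-T}$ denotes $(Q^{-1})^T$. The word "tri-diagonal" is used for a matrix with at most three consecutive nonzero diagonals; $Q$ is lower triangular, with nonzero entries only on its main diagonal and first two subdiagonals.
   Formalization: In (1), where the inverses need not exist if r_0=0 (e.g. r=0), the factorization is stated when r is not a.e. zero on (b_n,1), which is shown equivalent to M^1 and M^2 being invertible, and the formula for M_r^{-1} when M_r is invertible, shown to hold if r_0>0. *)

theory Defs
  imports "HOL-Analysis.Set_Integral" "HOL-Analysis.Lebesgue_Measure"
    "Jordan_Normal_Form.Gauss_Jordan_Elimination"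
begin

text \<open>
  Matrices are the \<open>(n+1) \<times> (n+1)\<close> matrices of the AFP entry
  Jordan Normal Form. Their entries are indexed from 0, so the entry \<open>(i, j)\<close> below is
  the entry \<open>(i+1, j+1)\<close> of the usual notation and \<open>b i\<close> is the breakpoint
  belonging to row \<open>i\<close>. The sequence \<open>b\<close> includes the end points
  \<open>b 0 = 0\<close> and \<open>b (n+1) = 1\<close>.
\<close>

definition Linfty01 :: "(real \<Rightarrow> real) \<Rightarrow> bool" where
  "Linfty01 r \<longleftrightarrow> r \<in> borel_measurable (lebesgue_on {0<..<1})
     \<and> (\<exists>C. AE x in lebesgue_on {0<..<1}. \<bar>r x\<bar> \<le> C)"

definition relu :: "real \<Rightarrow> real" where
  "relu t = max 0 t"

definition step :: "(nat \<Rightarrow> real) \<Rightarrow> nat \<Rightarrow> real" where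
  "step b i = b (i + 1) - b i"

text \<open>All integrals are over open intervals, so they do not depend on values of \<open>r\<close> outside
  \<open>(0, 1)\<close>.\<close>

definition mass_mat :: "nat \<Rightarrow> (real \<Rightarrow> real) \<Rightarrow> (nat \<Rightarrow> real) \<Rightarrow> real mat" where
  "mass_mat n r b = mat (n + 1) (n + 1)
     (\<lambda>(i, j). LINT x:{0<..<1}|lebesgue. r x * relu (x - b i) * relu (x - b j))"

definition beta1 :: "(real \<Rightarrow> real) \<Rightarrow> (nat \<Rightarrow> real) \<Rightarrow> nat \<Rightarrow> real" where
  "beta1 r b k = (LINT x:{b k<..<1}|lebesgue. r x * (x - 1) * (x - b k))"

definition alpha2 :: "(nat \<Rightarrow> real) \<Rightarrow> nat \<Rightarrow> real" where
  "alpha2 b k = 1 - b k"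

definition beta2 :: "(real \<Rightarrow> real) \<Rightarrow> (nat \<Rightarrow> real) \<Rightarrow> nat \<Rightarrow> real" where
  "beta2 r b k = (LINT x:{b k<..<1}|lebesgue. r x * (x - b k))"

definition M1_mat :: "nat \<Rightarrow> (real \<Rightarrow> real) \<Rightarrow> (nat \<Rightarrow> real) \<Rightarrow> real mat" where
  "M1_mat n r b = mat (n + 1) (n + 1) (\<lambda>(i, j). beta1 r b (max i j))"

definition M2_mat :: "nat \<Rightarrow> (real \<Rightarrow> real) \<Rightarrow> (nat \<Rightarrow> real) \<Rightarrow> real mat" where
  "M2_mat n r b = mat (n + 1) (n + 1)
     (\<lambda>(i, j). alpha2 b (min i j) * beta2 r b (max i j))"

text \<open>Total inverse; an unspecified matrix if the argument is not invertible.\<close>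

definition mat_inv :: "real mat \<Rightarrow> real mat" where
  "mat_inv A = the (mat_inverse A)"

definition G_mat :: "nat \<Rightarrow> real mat" where
  "G_mat n = mat (n + 1) (n + 1)
     (\<lambda>(i, j). if i = j then 1 else if i = j + 1 then -1 else 0)"

definition Dh_mat :: "nat \<Rightarrow> (nat \<Rightarrow> real) \<Rightarrow> real mat" where
  "Dh_mat n b = mat_diag (n + 1) (step b)"

definition s_moment :: "nat \<Rightarrow> (real \<Rightarrow> real) \<Rightarrow> (nat \<Rightarrow> real) \<Rightarrow> nat \<Rightarrow> real" where
  "s_moment k r b i = (LINT x:{b i<..<b (i + 1)}|lebesgue. r x * (x - b i) ^ k)"

definition Ds_mat :: "nat \<Rightarrow> nat \<Rightarrow> (real \<Rightarrow> real) \<Rightarrow> (nat \<Rightarrow> real) \<Rightarrow> real mat" where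
  "Ds_mat n k r b = mat_diag (n + 1) (s_moment k r b)"

definition D00_mat :: "nat \<Rightarrow> (real \<Rightarrow> real) \<Rightarrow> (nat \<Rightarrow> real) \<Rightarrow> real mat" where
  "D00_mat n r b = Ds_mat n 0 r b"

definition D01_mat :: "nat \<Rightarrow> (real \<Rightarrow> real) \<Rightarrow> (nat \<Rightarrow> real) \<Rightarrow> real mat" where
  "D01_mat n r b = mat_inv (Dh_mat n b) * Ds_mat n 1 r b"

definition D10_mat :: "nat \<Rightarrow> (real \<Rightarrow> real) \<Rightarrow> (nat \<Rightarrow> real) \<Rightarrow> real mat" where
  "D10_mat n r b = mat_inv (Dh_mat n b) * Ds_mat n 1 r b"

definition D11_mat :: "nat \<Rightarrow> (real \<Rightarrow> real) \<Rightarrow> (nat \<Rightarrow> real) \<Rightarrow> real mat" where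
  "D11_mat n r b = (mat_inv (Dh_mat n b) ^\<^sub>m 2) * Ds_mat n 2 r b"

definition Q_mat :: "nat \<Rightarrow> (nat \<Rightarrow> real) \<Rightarrow> real mat" where
  "Q_mat n b = G_mat n * mat_inv (Dh_mat n b) * G_mat n"

definition T_mat :: "nat \<Rightarrow> (real \<Rightarrow> real) \<Rightarrow> (nat \<Rightarrow> real) \<Rightarrow> real mat" where
  "T_mat n r b =
     (let G = G_mat n; GT = transpose_mat G; I = 1\<^sub>m (n + 1)
      in (I - GT) * D00_mat n r b * (I - G) + (I - GT) * D01_mat n r b * G
         + GT * D10_mat n r b * (I - G) + GT * D11_mat n r b * G)"

text \<open>At most three consecutive nonzero diagonals, which need not be centred at the main one:
  \<open>Q_mat\<close> is lower triangular with \<open>p = -2\<close>.\<close>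

definition tridiagonal :: "real mat \<Rightarrow> bool" where
  "tridiagonal A \<longleftrightarrow> (\<exists>p::int. \<forall>i < dim_row A. \<forall>j < dim_col A.
     A $$ (i, j) \<noteq> 0 \<longrightarrow> p \<le> int j - int i \<and> int j - int i \<le> p + 2)"

text \<open>A lower bound 0 for \<open>r\<close> does not make \<open>M1_mat\<close> and \<open>M2_mat\<close> invertible: their last
  columns are multiples of \<open>beta1 r b n\<close> and \<open>beta2 r b n\<close>, which vanish if \<open>r\<close> vanishes
  a.e. on \<open>(b n, 1)\<close>. This predicate excludes exactly that case, and a positive lower bound for
  \<open>r\<close> implies it. Invertibility of \<open>mass_mat\<close> is a still stronger condition on \<open>r\<close>.\<close>

definition nonvanishing_last :: "nat \<Rightarrow> (real \<Rightarrow> real) \<Rightarrow> (nat \<Rightarrow> real) \<Rightarrow> bool" where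
  "nonvanishing_last n r b \<longleftrightarrow> \<not> (AE x in lebesgue_on {b n<..<1}. r x = 0)"

end

theory Submission
  imports Defs "Jordan_Normal_Form.Determinant"
begin

text \<open>
  Let \<open>L\<close> be the lower triangular matrix of ones, so that \<open>G L = 1\<close>. A matrix with entries
  \<open>a (min i j) * c (max i j)\<close> equals \<open>A L\<^sup>T E L A\<close> with \<open>A = diag a\<close> and \<open>E\<close> diagonal, where
  the entries of \<open>E\<close> are the differences of \<open>c / a\<close>; its inverse
  \<open>A\<^sup>-\<^sup>1 G E\<^sup>-\<^sup>1 G\<^sup>T A\<^sup>-\<^sup>1\<close> is tridiagonal. Both summands of \<open>M = M1 + M2\<close> have this form,
  and the entries of \<open>E\<close> are, up to sign and a positive factor, integrals of \<open>r\<close> against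
  nonnegative functions that are positive on \<open>(b n, 1)\<close>. If \<open>r\<close> vanishes there, the last
  columns are zero.

  For the second factorization, \<open>Q\<^sup>-\<^sup>1 = L D L\<close> with \<open>D = diag h\<close>. On the interval
  \<open>(b k, b (k+1))\<close> the function \<open>relu (x - b j)\<close> is affine; its value at \<open>b k\<close> is the entry
  \<open>(k, j)\<close> of \<open>(I - G) Q\<^sup>-\<^sup>1\<close> and its increment that of \<open>G Q\<^sup>-\<^sup>1\<close>. Summing the integrals of the
  products over the intervals gives \<open>M = Q\<^sup>-\<^sup>T T Q\<^sup>-\<^sup>1\<close>.

  If \<open>r \<ge> r0 > 0\<close> and \<open>M v = 0\<close>, then \<open>0 = v\<^sup>T M v\<close> is the integral of \<open>r f\<^sup>2\<close>, where
  \<open>f x = (\<Sum>i. v i * relu (x - b i))\<close>. For the least \<open>k\<close> with \<open>v k \<noteq> 0\<close> one has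
  \<open>f x = v k * (x - b k)\<close> on \<open>(b k, b (k+1))\<close>, so that the integral is positive, a contradiction.
\<close>

subsection \<open>Inverses and banded matrices\<close>

lemma square_mult_carrier [simp]:
  "A \<in> carrier_mat N N \<Longrightarrow> B \<in> carrier_mat N N \<Longrightarrow> A * B \<in> carrier_mat N N"
  by simp

lemma cancel_left:
  fixes P R S :: "'a::semiring_1 mat"
  assumes "P * R = 1\<^sub>m N" "P \<in> carrier_mat N N" "R \<in> carrier_mat N N" "S \<in> carrier_mat N N"
  shows "P * (R * S) = S"
  using assms by (simp add: assoc_mult_mat[symmetric, of P N N R N S N])

lemma congruence_inverse:
  fixes D :: "'a::semiring_1 mat"
  assumes carrier: "D \<in> carrier_mat N N" "D' \<in> carrier_mat N N" "U \<in> carrier_mat N N" "U' \<in> carrier_mat N N"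
      "E \<in> carrier_mat N N" "E' \<in> carrier_mat N N" "L \<in> carrier_mat N N" "L' \<in> carrier_mat N N"
    and inv: "D * D' = 1\<^sub>m N" "U * U' = 1\<^sub>m N" "E * E' = 1\<^sub>m N" "L * L' = 1\<^sub>m N"
  shows "D * (U * E * L) * D * (D' * (L' * E' * U') * D') = 1\<^sub>m N"
  using carrier by (simp add: assoc_mult_mat[of _ N N _ N _ N] cancel_left inv)

text \<open>A right inverse of a square matrix over a field is also a left inverse. So
  \<open>A\<close> is a unit, elimination returns some inverse, and by uniqueness this is
  \<open>B\<close>.\<close>

lemma mat_inv_eqI:
  assumes A: "A \<in> carrier_mat N N" and B: "B \<in> carrier_mat N N" and AB: "A * B = 1\<^sub>m N"
  shows "mat_inv A = B" and "invertible_mat A"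
proof -
  have BA: "B * A = 1\<^sub>m N" by (rule mat_mult_left_right_inverse[OF A B AB])
  have "A \<in> Units (ring_mat TYPE(real) N ())"
    using A B AB BA by (auto simp: Units_def ring_mat_def)
  then obtain C where C: "mat_inverse A = Some C"
    using mat_inverse(1)[OF A, where b = "()"] by (cases "mat_inverse A") auto
  with mat_inverse(2)[OF A] have "C * A = 1\<^sub>m N" "C \<in> carrier_mat N N" by auto
  then have "C = C * (A * B)" by (simp add: AB)
  also have "\<dots> = (C * A) * B" using \<open>C \<in> _\<close> A B by simp
  also have "\<dots> = B" using \<open>C * A = _\<close> B by simp
  finally show "mat_inv A = B" by (simp add: mat_inv_def C)
  show "invertible_mat A"
    using A B AB BA by (auto simp: invertible_mat_def inverts_mat_def)
qed

lemma invertible_mat_inv: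
  assumes A: "A \<in> carrier_mat N N" and "invertible_mat A"
  shows "mat_inv A \<in> carrier_mat N N" and "A * mat_inv A = 1\<^sub>m N" and "mat_inv A * A = 1\<^sub>m N"
    and "mat_inv (mat_inv A) = A"
proof -
  obtain B where AB: "A * B = 1\<^sub>m N" and BA: "B * A = 1\<^sub>m (dim_row B)"
    using assms by (auto simp: invertible_mat_def inverts_mat_def)
  \<comment> \<open>\<open>inverts_mat\<close> does not prescribe the shape of \<open>B\<close>; it
    is read off the two product equations.\<close>
  have "dim_col B = N" using arg_cong[OF AB, of dim_col] by simp
  moreover have "dim_row B = N" using arg_cong[OF BA, of dim_col] A by simp
  ultimately have B: "B \<in> carrier_mat N N" by auto
  have eq: "mat_inv A = B" by (rule mat_inv_eqI[OF A B AB])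
  show "mat_inv A \<in> carrier_mat N N" "A * mat_inv A = 1\<^sub>m N" "mat_inv A * A = 1\<^sub>m N"
    using B AB BA by (auto simp: eq)
  then show "mat_inv (mat_inv A) = A"
    using mat_inv_eqI A by blast
qed

text \<open>A zero column of \<open>A\<close> stays zero in every product \<open>B * A\<close>,
  which is then not the identity.\<close>

lemma zero_col_not_invertible:
  fixes A :: "real mat"
  assumes A: "A \<in> carrier_mat N N" and j: "j < N" and zero: "\<And>i. i < N \<Longrightarrow> A $$ (i, j) = 0"
  shows "\<not> invertible_mat A"
proof
  assume "invertible_mat A"
  from invertible_mat_inv[OF A this]
  have B: "mat_inv A \<in> carrier_mat N N" and "mat_inv A * A = 1\<^sub>m N" by auto
  then have "(mat_inv A * A) $$ (j, j) = 1" using j by simp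
  moreover have "(mat_inv A * A) $$ (j, j) = 0"
    using A B j zero by (auto simp: scalar_prod_def)
  ultimately show False by simp
qed

text \<open>Both ends are recorded as signed offsets because these add under multiplication.\<close>

definition banded :: "int \<Rightarrow> int \<Rightarrow> 'a::zero mat \<Rightarrow> bool" where
  "banded p q A \<longleftrightarrow> (\<forall>i < dim_row A. \<forall>j < dim_col A.
     A $$ (i, j) \<noteq> 0 \<longrightarrow> p \<le> int j - int i \<and> int j - int i \<le> q)"

text \<open>Some term \<open>A $$ (i, k) * B $$ (k, j)\<close> is nonzero, and \<open>j - i\<close>
  is the sum of the offsets \<open>k - i\<close> and \<open>j - k\<close>.\<close>

lemma banded_mult:
  fixes A B :: "'a::semiring_0 mat"
  assumes "banded p q A" "banded p' q' B" "dim_col A = dim_row B"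
  shows "banded (p + p') (q + q') (A * B)"
  unfolding banded_def
proof (intro allI impI)
  fix i j
  assume ij: "i < dim_row (A * B)" "j < dim_col (A * B)" and nz: "(A * B) $$ (i, j) \<noteq> 0"
  then have "(\<Sum>k<dim_row B. A $$ (i, k) * B $$ (k, j)) \<noteq> 0"
    using assms(3) by (simp add: scalar_prod_def lessThan_atLeast0)
  then obtain k where "k < dim_row B" "A $$ (i, k) * B $$ (k, j) \<noteq> 0"
    by (meson lessThan_iff sum.neutral)
  then have "A $$ (i, k) \<noteq> 0" "B $$ (k, j) \<noteq> 0" by auto
  then show "p + p' \<le> int j - int i \<and> int j - int i \<le> q + q'"
    using assms ij \<open>k < dim_row B\<close> unfolding banded_def by (smt (verit) index_mult_mat(2,3))
qed

lemma banded_add: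
  fixes A B :: "'a::monoid_add mat"
  assumes "banded p q A" "banded p q B" "dim_row A = dim_row B" "dim_col A = dim_col B"
  shows "banded p q (A + B)"
  unfolding banded_def
proof (intro allI impI)
  fix i j
  assume ij: "i < dim_row (A + B)" "j < dim_col (A + B)" and "(A + B) $$ (i, j) \<noteq> 0"
  then have "A $$ (i, j) \<noteq> 0 \<or> B $$ (i, j) \<noteq> 0" by auto
  then show "p \<le> int j - int i \<and> int j - int i \<le> q"
    using assms ij by (auto simp: banded_def)
qed

lemma banded_transpose: "banded p q A \<Longrightarrow> banded (- q) (- p) (transpose_mat A)"
  by (auto simp: banded_def) force+

lemma banded_mat_diag: "banded 0 0 (mat_diag N f)"
  by (auto simp: banded_def mat_diag_def split: if_splits)

lemma banded_tridiagonal: "banded p q A \<Longrightarrow> q \<le> p + 2 \<Longrightarrow> tridiagonal A"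
  unfolding banded_def tridiagonal_def by (intro exI[of _ p]) fastforce

section \<open>Summation and difference matrices\<close>

definition lower_ones :: "nat \<Rightarrow> real mat" where
  "lower_ones n = mat (n + 1) (n + 1) (\<lambda>(i, j). if j \<le> i then 1 else 0)"

lemma lower_ones_carrier [simp]:
  "lower_ones n \<in> carrier_mat (n + 1) (n + 1)"
  and lower_ones_carrier_Suc [simp]: "lower_ones n \<in> carrier_mat (Suc n) (Suc n)"
  by (simp_all add: lower_ones_def)

lemma G_mat_carrier [simp]:
  "G_mat n \<in> carrier_mat (n + 1) (n + 1)"
  and G_mat_carrier_Suc [simp]: "G_mat n \<in> carrier_mat (Suc n) (Suc n)"
  by (simp_all add: G_mat_def)

lemma G_mat_lower_ones: "G_mat n * lower_ones n = 1\<^sub>m (n + 1)"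
proof (rule eq_matI)
  fix i j assume "i < dim_row (1\<^sub>m (n + 1))" "j < dim_col (1\<^sub>m (n + 1))"
  then have ij: "i < n + 1" "j < n + 1" by auto
  have "(G_mat n * lower_ones n) $$ (i, j) =
      (\<Sum>k<n + 1. (if k = i then 1 else if i = k + 1 then -1 else 0) * (if j \<le> k then 1 else 0))"
    using ij by (auto simp: G_mat_def lower_ones_def scalar_prod_def lessThan_atLeast0
        intro!: sum.cong)
  also have "\<dots> = (\<Sum>k<n + 1. (if k = i then if j \<le> i then 1 else 0 else 0)
      + (if i = k + 1 then if j + 1 \<le> i then -1 else 0 else 0))"
    by (intro sum.cong) auto
  \<comment> \<open>In row \<open>0\<close> there is no \<open>k\<close> with
    \<open>i = k + 1\<close>; the closed form agrees because \<open>j + 1 \<le> 0\<close> is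
    false.\<close>
  also have "\<dots> = (if j \<le> i then 1 else 0) + (if j + 1 \<le> i then -1 else 0)"
    using ij by (cases i) (simp_all add: sum.distrib del: sum.lessThan_Suc)
  finally show "(G_mat n * lower_ones n) $$ (i, j) = 1\<^sub>m (n + 1) $$ (i, j)"
    using ij by simp
qed (auto simp: G_mat_def lower_ones_def)

lemmas lower_ones_G_mat = mat_mult_left_right_inverse[OF G_mat_carrier lower_ones_carrier G_mat_lower_ones]

lemma banded_G_mat: "banded (-1) 0 (G_mat n)"
  by (auto simp: banded_def G_mat_def split: if_splits)

lemma mat_diag_inverse:
  assumes "\<And>i. i < N \<Longrightarrow> f i \<noteq> (0::real)"
  shows "mat_diag N f * mat_diag N (\<lambda>i. 1 / f i) = 1\<^sub>m N"
    and "mat_diag N (\<lambda>i. 1 / f i) * mat_diag N f = 1\<^sub>m N"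
  using assms by (simp_all, auto simp: mat_diag_def)

lemma transpose_diag_mult_index:
  fixes X Y :: "'a::comm_semiring_0 mat"
  assumes "X \<in> carrier_mat N N" "Y \<in> carrier_mat N N" "i < N" "j < N"
  shows "(transpose_mat X * mat_diag N d * Y) $$ (i, j) = (\<Sum>k<N. X $$ (k, i) * d k * Y $$ (k, j))"
  using assms by (subst mat_diag_mult_right[where n=N and nr=N])
    (auto simp: scalar_prod_def lessThan_atLeast0 intro!: sum.cong)

section \<open>Green matrices and their tridiagonal inverses\<close>

definition green_mat :: "nat \<Rightarrow> (nat \<Rightarrow> real) \<Rightarrow> (nat \<Rightarrow> real) \<Rightarrow> real mat" where
  "green_mat n a c = mat (n + 1) (n + 1) (\<lambda>(i, j). a (min i j) * c (max i j))"

text \<open>As \<open>min i j\<close> and \<open>max i j\<close> are \<open>i\<close> and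
  \<open>j\<close> in some order, removing the factors \<open>a i\<close> and \<open>a j\<close>
  leaves \<open>c / a\<close> at \<open>max i j\<close>. This is the tail sum of \<open>d\<close>
  from \<open>max i j\<close> on, which is what the middle product computes.\<close>

lemma green_mat_factorization:
  fixes a c :: "nat \<Rightarrow> real"
  assumes a: "\<And>i. i \<le> n \<Longrightarrow> a i \<noteq> 0"
  defines "d \<equiv> \<lambda>i. c i / a i - (if i < n then c (i + 1) / a (i + 1) else 0)"
  shows "green_mat n a c = mat_diag (n + 1) a * (transpose_mat (lower_ones n) * mat_diag (n + 1) d
    * lower_ones n) * mat_diag (n + 1) a" (is "_ = ?D * ?X * ?D")
proof (rule eq_matI)
  \<comment> \<open>The case distinction in \<open>d\<close> continues \<open>c / a\<close> by zero
    beyond \<open>n\<close>, so the tail sums telescope to their first term.\<close>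
  have tail: "(\<Sum>k = m..n. d k) = c m / a m" if "m \<le> n" for m
    using that
  proof (induction m rule: inc_induct)
    case base
    show ?case by (simp add: d_def)
  next
    case (step m)
    then have "(\<Sum>k = m..n. d k) = d m + (\<Sum>k = Suc m..n. d k)"
      by (simp add: sum.atLeast_Suc_atMost)
    with step show ?case by (simp add: d_def)
  qed
  fix i j assume "i < dim_row (?D * ?X * ?D)" "j < dim_col (?D * ?X * ?D)"
  then have ij: "i < n + 1" "j < n + 1" by (simp_all add: mat_diag_def)
  have X: "?X \<in> carrier_mat (n + 1) (n + 1)"
    by simp
  have "?X $$ (i, j) = (\<Sum>k<n + 1. (if i \<le> k then 1 else 0) * d k * (if j \<le> k then 1 else 0))"
    using ij by (subst transpose_diag_mult_index) (auto simp: lower_ones_def intro!: sum.cong)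
  also have "\<dots> = (\<Sum>k = max i j..n. d k)"
    by (intro sum.mono_neutral_cong_right) auto
  also have "\<dots> = c (max i j) / a (max i j)" using ij by (intro tail) auto
  finally have *: "?X $$ (i, j) = c (max i j) / a (max i j)" .
  have "(?D * Y * ?D) $$ (i, j) = a i * Y $$ (i, j) * a j" if "Y \<in> carrier_mat (n + 1) (n + 1)" for Y
    using ij that
    by (simp add: mat_diag_mult_left[OF that] mat_diag_mult_right[of _ "n + 1" "n + 1"] del: One_nat_def)
  from this[OF X] have "(?D * ?X * ?D) $$ (i, j) = a i * ?X $$ (i, j) * a j" .
  then show "green_mat n a c $$ (i, j) = (?D * ?X * ?D) $$ (i, j)"
    using ij a[of i] a[of j] unfolding * by (auto simp: green_mat_def max_def min_def)
qed (auto simp: green_mat_def mat_diag_def)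

text \<open>The hypotheses on \<open>c n\<close> and on the cross products say that all entries of
  the middle diagonal factor are nonzero, so every factor can be inverted.\<close>

lemma green_mat_inverse:
  assumes a: "\<And>i. i \<le> n \<Longrightarrow> a i \<noteq> 0" and c: "c n \<noteq> 0"
    and w: "\<And>i. i < n \<Longrightarrow> a (i + 1) * c i \<noteq> a i * c (i + 1)"
  shows "invertible_mat (green_mat n a c)" and "banded (-1) 1 (mat_inv (green_mat n a c))"
proof -
  define d where "d = (\<lambda>i. c i / a i - (if i < n then c (i + 1) / a (i + 1) else 0))"
  let ?N = "n + 1" and ?L = "lower_ones n" and ?G = "G_mat n"
  let ?D = "mat_diag ?N a" and ?Di = "mat_diag ?N (\<lambda>i. 1 / a i)"
  let ?E = "mat_diag ?N d" and ?Ei = "mat_diag ?N (\<lambda>i. 1 / d i)"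
  let ?LT = "transpose_mat ?L" and ?GT = "transpose_mat ?G"
  have d: "d i \<noteq> 0" if "i < ?N" for i
  proof (cases "i < n")
    case True
    then show ?thesis using a[of i] a[of "i + 1"] w[of i] by (auto simp: d_def field_simps)
  next
    case False
    with that have "i = n" by simp
    then show ?thesis using a[of n] c by (simp add: d_def)
  qed
  note DD = mat_diag_inverse[of ?N a] and EE = mat_diag_inverse[of ?N d, OF d]
  have GL: "?LT * ?GT = 1\<^sub>m ?N" "?L * ?G = 1\<^sub>m ?N"
    using transpose_mult[of ?G ?N ?N ?L ?N]
    by (simp_all only: G_mat_lower_ones lower_ones_G_mat G_mat_carrier lower_ones_carrier
        transpose_one simp_thms)
  let ?B = "?Di * (?G * ?Ei * ?GT) * ?Di"
  have "green_mat n a c = ?D * (?LT * ?E * ?L) * ?D"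
    unfolding d_def by (rule green_mat_factorization[OF a])
  moreover have "?D * (?LT * ?E * ?L) * ?D * ?B = 1\<^sub>m ?N"
    by (rule congruence_inverse[where N = ?N])
      (use a in \<open>simp_all add: DD EE GL del: mat_diag_diag One_nat_def\<close>)
  ultimately have AB: "green_mat n a c * ?B = 1\<^sub>m ?N" by simp
  have A: "green_mat n a c \<in> carrier_mat ?N ?N" by (simp add: green_mat_def)
  have B: "?B \<in> carrier_mat ?N ?N" by simp
  show "invertible_mat (green_mat n a c)" by (rule mat_inv_eqI(2)[OF A B AB])
  have "banded 0 1 ?GT" using banded_transpose[OF banded_G_mat, of n] by simp
  \<comment> \<open>Only \<open>G_mat\<close> and its transpose widen the band, by one below and one
    above the diagonal; the sums follow the bracketing of \<open>?B\<close>.\<close>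
  then have "banded (0 + ((-1 + 0) + 0) + 0) (0 + ((0 + 0) + 1) + 0) ?B"
    by (intro banded_mult banded_mat_diag banded_G_mat) (auto simp: G_mat_def mat_diag_def)
  then show "banded (-1) 1 (mat_inv (green_mat n a c))"
    by (simp add: mat_inv_eqI(1)[OF A B AB])
qed

text \<open>The two triangular factors leave only the indices \<open>k\<close> between
  \<open>j\<close> and \<open>i\<close>, none if \<open>i < j\<close>. With the steps as weights the
  sum telescopes.\<close>

lemma lower_ones_diag_lower_ones_index:
  assumes "i \<le> n" "j \<le> n"
  shows "(lower_ones n * mat_diag (n + 1) d * lower_ones n) $$ (i, j) = (\<Sum>k = j..i. d k)"
proof -
  have "(lower_ones n * mat_diag (n + 1) d * lower_ones n) $$ (i, j)
      = (\<Sum>k<n + 1. (if k \<le> i then 1 else 0) * d k * (if j \<le> k then 1 else 0))"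
    using assms by (subst mat_diag_mult_right[OF lower_ones_carrier])
      (auto simp: scalar_prod_def lower_ones_def lessThan_atLeast0 intro!: sum.cong)
  also have "\<dots> = (\<Sum>k = j..i. d k)"
    using assms by (intro sum.mono_neutral_cong_right) auto
  finally show ?thesis .
qed

lemma congruence_transpose_mult:
  fixes K X D Y :: "real mat"
  assumes "K \<in> carrier_mat N N" "X \<in> carrier_mat N N" "D \<in> carrier_mat N N" "Y \<in> carrier_mat N N"
  shows "transpose_mat K * (transpose_mat X * D * Y) * K = transpose_mat (X * K) * D * (Y * K)"
  using assms by (simp add: transpose_mult[of X N N K N] assoc_mult_mat[of _ N N _ N _ N])

subsection \<open>Integrals against an essentially bounded weight\<close>

text \<open>All integrals are brought to the common domain \<open>(0, 1)\<close>, with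
  \<open>relu\<close> cutting off the test function, so that relations between them follow by
  linearity in \<open>g\<close>.\<close>

definition weighted_integral :: "(real \<Rightarrow> real) \<Rightarrow> (real \<Rightarrow> real) \<Rightarrow> real" where
  "weighted_integral r g = (LINT x:{0<..<1}|lebesgue. r x * g x)"

text \<open>\<open>r\<close> is essentially bounded and \<open>g\<close> is bounded on the compact
  interval \<open>[0, 1]\<close>, so the product is bounded a.e. on a space of finite
  measure.\<close>

lemma Linfty01_integrable:
  assumes r: "Linfty01 r" and g: "continuous_on UNIV g" and S: "S \<in> sets lebesgue" "S \<subseteq> {0<..<1}"
  shows "set_integrable lebesgue S (\<lambda>x. r x * g x)"
proof -
  let ?M = "lebesgue_on {0<..<1::real}"
  interpret finite_measure ?M
    by (rule finite_measureI) (simp add: emeasure_restrict_space space_restrict_space)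
  obtain C where C: "AE x in ?M. \<bar>r x\<bar> \<le> C" and rm: "r \<in> borel_measurable ?M"
    using r by (auto simp: Linfty01_def)
  have "bounded (g ` {0..1})"
    by (intro compact_imp_bounded compact_continuous_image continuous_on_subset[OF g]) auto
  then obtain B where B: "\<forall>x\<in>{0..1}. \<bar>g x\<bar> \<le> B"
    by (auto simp: bounded_iff)
  have "integrable ?M (\<lambda>x. r x * g x)"
  proof (rule integrable_const_bound[where B = "C * B"])
    have "AE x in ?M. x \<in> {0<..<1}" by (auto simp: AE_restrict_space_iff)
    with C show "AE x in ?M. norm (r x * g x) \<le> C * B"
    proof eventually_elim
      case (elim x)
      with B show ?case by (auto simp: abs_mult intro!: mult_mono)
    qed
    have "g \<in> borel_measurable borel" by (rule borel_measurable_continuous_onI[OF g])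
    then have "g \<in> borel_measurable ?M"
      by (intro measurable_restrict_space1 measurable_completion) simp
    then show "(\<lambda>x. r x * g x) \<in> borel_measurable ?M" using rm by measurable
  qed
  then have "set_integrable lebesgue {0<..<1} (\<lambda>x. r x * g x)"
    unfolding set_integrable_def by (subst (asm) integrable_restrict_space) auto
  then show ?thesis using S by (rule set_integrable_subset)
qed

text \<open>The integrand is nonnegative a.e., so a zero integral makes \<open>r * g\<close> vanish
  a.e.; where \<open>g\<close> is positive, \<open>r\<close> itself must then vanish.\<close>

lemma weighted_integral_pos:
  assumes r: "Linfty01 r" and r0: "AE x in lebesgue_on {0<..<1}. 0 \<le> r x"
    and g: "continuous_on UNIV g" "\<And>x. 0 < x \<Longrightarrow> x < 1 \<Longrightarrow> 0 \<le> g x"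
    and S: "{u<..<v} \<subseteq> {0<..<1}" "\<And>x. u < x \<Longrightarrow> x < v \<Longrightarrow> 0 < g x"
    and nz: "\<not> (AE x in lebesgue_on {u<..<v}. r x = 0)"
  shows "0 < weighted_integral r g"
proof -
  let ?f = "\<lambda>x. indicator {0<..<1} x *\<^sub>R (r x * g x)"
  have int: "integrable lebesgue ?f"
    using Linfty01_integrable[OF r g(1), of "{0<..<1}"] by (simp add: set_integrable_def)
  have nonneg: "AE x in lebesgue. 0 \<le> ?f x"
    using r0 g(2) by (auto simp: AE_restrict_space_iff indicator_def elim!: eventually_mono)
  have "integral\<^sup>L lebesgue ?f \<noteq> 0"
  proof
    assume "integral\<^sup>L lebesgue ?f = 0"
    then have "AE x in lebesgue. ?f x = 0"
      using integral_nonneg_eq_0_iff_AE[OF int nonneg] by simp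
    then have "AE x in lebesgue. x \<in> {u<..<v} \<longrightarrow> r x = 0"
    proof eventually_elim
      case (elim x)
      then show ?case using S(1) S(2)[of x] by (auto simp: indicator_def)
    qed
    with nz show False by (simp add: AE_restrict_space_iff)
  qed
  moreover have "0 \<le> integral\<^sup>L lebesgue ?f" by (rule integral_nonneg_AE[OF nonneg])
  ultimately show ?thesis by (simp add: weighted_integral_def set_lebesgue_integral_def)
qed

lemma relu_simps: "0 \<le> t \<Longrightarrow> relu t = t" "t \<le> 0 \<Longrightarrow> relu t = 0"
  by (auto simp: relu_def)

lemma relu_nonneg: "0 \<le> relu t"
  by (simp add: relu_def)

lemma continuous_on_relu [continuous_intros]:
  "continuous_on S f \<Longrightarrow> continuous_on S (\<lambda>x. relu (f x))"
  unfolding relu_def by (intro continuous_intros)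

subsection \<open>The mass matrix\<close>

locale weighted_breakpoints =
  fixes n :: nat and b :: "nat \<Rightarrow> real" and r :: "real \<Rightarrow> real"
  assumes b0: "b 0 = 0" and b_end: "b (n + 1) = 1" and b_step: "\<And>i. i \<le> n \<Longrightarrow> b i < b (i + 1)"
    and r: "Linfty01 r" and r_nonneg: "AE x in lebesgue_on {0<..<1}. 0 \<le> r x"
begin

lemma b_mono: "i \<le> j \<Longrightarrow> j \<le> n + 1 \<Longrightarrow> b i \<le> b j"
  by (induction j rule: dec_induct) (use b_step in fastforce)+

lemma b_nonneg: "i \<le> n + 1 \<Longrightarrow> 0 \<le> b i"
  using b_mono[of 0 i] b0 by simp

lemma b_le_1: "i \<le> n + 1 \<Longrightarrow> b i \<le> 1"
  using b_mono[of i "n + 1"] b_end by simp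

lemma b_less_1: "i \<le> n \<Longrightarrow> b i < 1"
  using b_step[of i] b_le_1[of "i + 1"] by simp

text \<open>The open subintervals miss only breakpoints, a finite set of measure zero.\<close>

lemma set_integral_partition:
  fixes f :: "real \<Rightarrow> real"
  assumes f: "set_integrable lebesgue {0<..<1} f"
  shows "(LINT x:{0<..<1}|lebesgue. f x) = (\<Sum>k<n + 1. LINT x:{b k<..<b (k + 1)}|lebesgue. f x)"
proof -
  let ?U = "\<Union>k<n + 1. {b k<..<b (k + 1)}"
  have sub: "{b k<..<b (k + 1)} \<subseteq> {0<..<1}" if "k < n + 1" for k
    using b_nonneg[of k] b_le_1[of "k + 1"] that by auto
  have "{0<..<1} - ?U \<subseteq> b ` {..n + 1}"
  proof
    fix x assume x: "x \<in> {0<..<1} - ?U"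
    \<comment> \<open>\<open>b k\<close> is the first breakpoint not left of \<open>x\<close>, so
      \<open>x\<close> equals \<open>b k\<close> or lies in the open interval before it.\<close>
    define k where "k = (LEAST k. x \<le> b k)"
    have "x \<le> b (n + 1)" using x b_end by auto
    then have k: "x \<le> b k" "k \<le> n + 1" and lt: "\<And>i. i < k \<Longrightarrow> b i < x"
      unfolding k_def by (auto intro: LeastI Least_le dest!: not_less_Least)
    have "k \<noteq> 0" using k(1) x b0 by (intro notI) auto
    then obtain m where m: "k = m + 1" by (cases k) auto
    have "x \<notin> {b m<..<b (m + 1)}" using x k(2) m by auto
    then have "x = b k" using lt[of m] k(1) m by auto
    then show "x \<in> b ` {..n + 1}" using k(2) by auto
  qed
  then have "(LINT x:{0<..<1}|lebesgue. f x) = (LINT x:?U|lebesgue. f x)"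
    using sub by (intro set_integral_discrete_difference[where X = "b ` {..n + 1}"])
      (auto intro!: countable_finite)
  also have "\<dots> = (\<Sum>k<n + 1. LINT x:{b k<..<b (k + 1)}|lebesgue. f x)"
  proof (rule set_integral_finite_Union)
    show "disjoint_family_on (\<lambda>k. {b k<..<b (k + 1)}) {..<n + 1}"
      unfolding disjoint_family_on_def
    proof (intro ballI impI)
      fix i j assume ij: "i \<in> {..<n + 1}" "j \<in> {..<n + 1}" "i \<noteq> j"
      then have "i + 1 \<le> j \<or> j + 1 \<le> i" by auto
      then show "{b i<..<b (i + 1)} \<inter> {b j<..<b (j + 1)} = {}"
        using b_mono[of "i + 1" j] b_mono[of "j + 1" i] ij by auto
    qed
    show "set_integrable lebesgue {b i<..<b (i + 1)} f" if "i \<in> {..<n + 1}" for i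
      using sub[of i] that by (intro set_integrable_subset[OF f]) auto
  qed auto
  finally show ?thesis .
qed

section \<open>The weighted integral as a linear functional\<close>

abbreviation J :: "(real \<Rightarrow> real) \<Rightarrow> real" where
  "J \<equiv> weighted_integral r"

lemma J_add:
  assumes "continuous_on UNIV f" "continuous_on UNIV g"
  shows "J (\<lambda>x. f x + g x) = J f + J g"
  unfolding weighted_integral_def
  by (simp add: ring_distribs set_integral_add Linfty01_integrable[OF r] assms)

lemma J_cmult: "J (\<lambda>x. c * g x) = c * J g"
  unfolding weighted_integral_def by (simp add: mult.left_commute)

lemma J_sum:
  assumes "finite A" "\<And>i. i \<in> A \<Longrightarrow> continuous_on UNIV (g i)"
  shows "J (\<lambda>x. \<Sum>i\<in>A. g i x) = (\<Sum>i\<in>A. J (g i))"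
  using assms
proof (induction A rule: finite_induct)
  case empty
  then show ?case by (simp add: weighted_integral_def set_lebesgue_integral_def)
next
  case (insert a A)
  then have "continuous_on UNIV (\<lambda>x. \<Sum>i\<in>A. g i x)" by (intro continuous_on_sum) auto
  with insert show ?case by (simp add: J_add)
qed

lemma J_diff:
  assumes "continuous_on UNIV f" "continuous_on UNIV g"
  shows "J (\<lambda>x. f x - g x) = J f - J g"
  using J_add[of f "\<lambda>x. (-1) * g x"] assms J_cmult[of "-1" g]
  by (simp add: continuous_on_minus)

lemmas J_pos = weighted_integral_pos[OF r r_nonneg]

text \<open>The factor \<open>relu (x - b k)\<close> vanishes left of \<open>b k\<close>, so the
  domain extends to \<open>(0, 1)\<close>.\<close>

lemma beta1_eq: "k \<le> n \<Longrightarrow> beta1 r b k = J (\<lambda>x. (x - 1) * relu (x - b k))"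
  using b_nonneg[of k]
  unfolding beta1_def weighted_integral_def set_lebesgue_integral_def
  by (intro Bochner_Integration.integral_cong) (auto simp: indicator_def relu_def)

lemma beta2_eq: "k \<le> n \<Longrightarrow> beta2 r b k = J (\<lambda>x. relu (x - b k))"
  using b_nonneg[of k]
  unfolding beta2_def weighted_integral_def set_lebesgue_integral_def
  by (intro Bochner_Integration.integral_cong) (auto simp: indicator_def relu_def)

lemma mass_mat_index:
  "i \<le> n \<Longrightarrow> j \<le> n \<Longrightarrow> mass_mat n r b $$ (i, j) = J (\<lambda>x. relu (x - b i) * relu (x - b j))"
  by (simp add: mass_mat_def weighted_integral_def mult.assoc)

section \<open>The two Green summands of the mass matrix\<close>

lemma M1_green: "M1_mat n r b = green_mat n (\<lambda>_. 1) (beta1 r b)"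
  by (simp add: M1_mat_def green_mat_def)

lemma M2_green: "M2_mat n r b = green_mat n (alpha2 b) (beta2 r b)"
  by (simp add: M2_mat_def green_mat_def)

text \<open>For \<open>p \<le> q\<close> the factor \<open>relu (x - b q)\<close> vanishes up to
  \<open>b q\<close>; beyond it the other factor is \<open>x - b p = (x - 1) + (1 - b p)\<close>,
  and the two terms yield \<open>M1_mat\<close> and \<open>M2_mat\<close>.\<close>

lemma mass_mat_eq_sum: "mass_mat n r b = M1_mat n r b + M2_mat n r b"
proof (rule eq_matI)
  fix i j assume "i < dim_row (M1_mat n r b + M2_mat n r b)" "j < dim_col (M1_mat n r b + M2_mat n r b)"
  then have ij: "i \<le> n" "j \<le> n" by (auto simp: M2_mat_def)
  define p q where "p = min i j" and "q = max i j"
  have pq: "p \<le> q" "q \<le> n" "p \<le> n" using ij by (auto simp: p_def q_def)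
  have "relu (x - b i) * relu (x - b j) = (x - 1) * relu (x - b q) + (1 - b p) * relu (x - b q)" for x
  proof -
    have "relu (x - b i) * relu (x - b j) = relu (x - b p) * relu (x - b q)"
      by (simp add: p_def q_def min_def max_def)
    also have "\<dots> = (x - b p) * relu (x - b q)"
      using b_mono[of p q] pq by (auto simp: relu_def max_def)
    finally show ?thesis by (simp add: algebra_simps)
  qed
  then have "mass_mat n r b $$ (i, j) = J (\<lambda>x. (x - 1) * relu (x - b q)) + (1 - b p) * J (\<lambda>x. relu (x - b q))"
    using ij by (simp add: mass_mat_index, subst J_add)
      (auto simp: J_cmult intro!: continuous_intros)
  then show "mass_mat n r b $$ (i, j) = (M1_mat n r b + M2_mat n r b) $$ (i, j)"
    using ij pq by (simp add: M1_mat_def M2_mat_def p_def[symmetric] q_def[symmetric] alpha2_def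
        beta1_eq beta2_eq)
qed (auto simp: mass_mat_def M2_mat_def)

text \<open>With constant \<open>a\<close> the criterion asks that consecutive values of
  \<open>beta1\<close> differ and the last is nonzero. As \<open>x - 1\<close> is negative on
  \<open>(0, 1)\<close>, signs are reversed before positivity applies.\<close>

lemma M1_inverse:
  assumes nz: "nonvanishing_last n r b"
  shows "invertible_mat (M1_mat n r b)" and "banded (-1) 1 (mat_inv (M1_mat n r b))"
proof -
  have nz': "\<not> (AE x in lebesgue_on {b n<..<1}. r x = 0)"
    using nz by (simp add: nonvanishing_last_def)
  have "0 < J (\<lambda>x. (1 - x) * relu (x - b n))"
    by (rule J_pos[OF _ _ _ _ nz'])
      (use b_nonneg[of n] in \<open>auto simp: relu_def intro!: continuous_intros\<close>)
  moreover have "beta1 r b n = - J (\<lambda>x. (1 - x) * relu (x - b n))"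
    using J_cmult[of "-1" "\<lambda>x. (1 - x) * relu (x - b n)"] by (simp add: beta1_eq algebra_simps)
  ultimately have last: "beta1 r b n \<noteq> 0" by simp
  have diff: "beta1 r b i \<noteq> beta1 r b (i + 1)" if i: "i < n" for i
  proof -
    have bi: "b i < b (i + 1)" "b (i + 1) \<le> b n" using b_step[of i] b_mono[of "i + 1" n] i by auto
    \<comment> \<open>The difference of the two \<open>relu\<close> terms is nonnegative and equals
      \<open>b (i + 1) - b i\<close> to the right of \<open>b (i + 1)\<close>, in particular on
      \<open>(b n, 1)\<close>.\<close>
    have "0 < J (\<lambda>x. (1 - x) * (relu (x - b i) - relu (x - b (i + 1))))"
      by (rule J_pos[OF _ _ _ _ nz'])
        (use b_nonneg[of n] bi in \<open>auto simp: relu_def intro!: continuous_intros mult_nonneg_nonneg\<close>)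
    also have "\<dots> = J (\<lambda>x. (x - 1) * relu (x - b (i + 1)) - (x - 1) * relu (x - b i))"
      by (simp add: algebra_simps)
    also have "\<dots> = beta1 r b (i + 1) - beta1 r b i"
      using i by (subst J_diff) (auto simp: beta1_eq intro!: continuous_intros)
    finally show ?thesis by simp
  qed
  show "invertible_mat (M1_mat n r b)" "banded (-1) 1 (mat_inv (M1_mat n r b))"
    unfolding M1_green using last diff by (auto intro!: green_mat_inverse simp del: One_nat_def)
qed

lemma M2_inverse:
  assumes nz: "nonvanishing_last n r b"
  shows "invertible_mat (M2_mat n r b)" and "banded (-1) 1 (mat_inv (M2_mat n r b))"
proof -
  have nz': "\<not> (AE x in lebesgue_on {b n<..<1}. r x = 0)"
    using nz by (simp add: nonvanishing_last_def)
  have "0 < J (\<lambda>x. relu (x - b n))"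
    by (rule J_pos[OF _ _ _ _ nz'])
      (use b_nonneg[of n] in \<open>auto simp: relu_def intro!: continuous_intros\<close>)
  then have last: "beta2 r b n \<noteq> 0" by (simp add: beta2_eq)
  have diff: "alpha2 b (i + 1) * beta2 r b i \<noteq> alpha2 b i * beta2 r b (i + 1)" if i: "i < n" for i
  proof -
    have bi: "b i < b (i + 1)" "b (i + 1) \<le> b n" "b n < 1"
      using b_step[of i] b_mono[of "i + 1" n] b_less_1[of n] i by auto
    \<comment> \<open>A hat function: zero up to \<open>b i\<close>, increasing up to
      \<open>b (i + 1)\<close>, then linear down to zero at \<open>1\<close>. Its weighted integral
      is the cross difference in \<open>green_mat_inverse\<close>.\<close>
    let ?g = "\<lambda>x. (1 - b (i + 1)) * relu (x - b i) - (1 - b i) * relu (x - b (i + 1))"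
    have g: "?g x = (b (i + 1) - b i) * (1 - x)" if "b (i + 1) \<le> x" for x
      using that bi by (simp add: relu_simps algebra_simps)
    have "0 < J ?g"
    proof (rule J_pos[OF _ _ _ _ nz'])
      show "continuous_on UNIV ?g" by (intro continuous_intros)
      show "0 \<le> ?g x" if "0 < x" "x < 1" for x
      proof (cases "b (i + 1) \<le> x")
        case True
        then show ?thesis unfolding g[OF True] using bi that by simp
      next
        case False
        then have "relu (x - b (i + 1)) = 0" by (simp add: relu_simps(2))
        then show ?thesis using bi relu_nonneg[of "x - b i"] by simp
      qed
      show "0 < ?g x" if "b n < x" "x < 1" for x
        using bi that by (subst g) auto
    qed (use b_nonneg[of n] in auto)
    also have "J ?g = (1 - b (i + 1)) * beta2 r b i - (1 - b i) * beta2 r b (i + 1)"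
      using i by (subst J_diff) (auto simp: beta2_eq J_cmult intro!: continuous_intros)
    finally show ?thesis by (simp add: alpha2_def)
  qed
  have "alpha2 b i \<noteq> 0" if "i \<le> n" for i using b_less_1[OF that] by (simp add: alpha2_def)
  with last diff show "invertible_mat (M2_mat n r b)" "banded (-1) 1 (mat_inv (M2_mat n r b))"
    unfolding M2_green by (auto intro!: green_mat_inverse simp del: One_nat_def)
qed

text \<open>Up to a scalar, each entry in the last column of the three matrices is an integral of
  \<open>r\<close> against a multiple of \<open>relu (x - b n)\<close>, hence zero.\<close>

lemma vanishing_last:
  assumes "\<not> nonvanishing_last n r b"
  shows "\<not> invertible_mat (M1_mat n r b)" "\<not> invertible_mat (M2_mat n r b)"
    "\<not> invertible_mat (mass_mat n r b)"
proof -
  have "AE x in lebesgue. x \<in> {b n<..<1} \<longrightarrow> r x = 0"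
    using assms by (simp add: nonvanishing_last_def AE_restrict_space_iff)
  then have J0: "J (\<lambda>x. g x * relu (x - b n)) = 0" for g
    unfolding weighted_integral_def set_lebesgue_integral_def
    by (intro integral_eq_zero_AE, elim eventually_mono) (auto simp: indicator_def relu_def)
  have "beta1 r b n = 0" "beta2 r b n = 0" using J0 J0[of "\<lambda>_. 1"] by (simp_all add: beta1_eq beta2_eq)
  then show "\<not> invertible_mat (M1_mat n r b)" "\<not> invertible_mat (M2_mat n r b)"
    by (intro zero_col_not_invertible[of _ "n + 1" n]; simp add: M1_mat_def M2_mat_def max_def)+
  show "\<not> invertible_mat (mass_mat n r b)"
  proof (rule zero_col_not_invertible[of _ "n + 1" n])
    show "mass_mat n r b $$ (i, n) = 0" if "i < n + 1" for i
      using that J0 by (simp add: mass_mat_index)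
  qed (auto simp: mass_mat_def)
qed

section \<open>The matrix \<open>Q\<close> and its inverse\<close>

lemma sum_step: "j \<le> i \<Longrightarrow> (\<Sum>k = j..i. step b k) = b (i + 1) - b j"
  by (induction i rule: dec_induct) (auto simp: step_def)

lemma Dh_inverse:
  shows "invertible_mat (Dh_mat n b)" and "mat_inv (Dh_mat n b) = mat_diag (n + 1) (\<lambda>i. 1 / step b i)"
proof -
  have "step b i \<noteq> 0" if "i < n + 1" for i
    using b_step[of i] that by (simp add: step_def)
  note D = mat_diag_inverse(1)[of "n + 1" "step b", OF this]
  show "invertible_mat (Dh_mat n b)" "mat_inv (Dh_mat n b) = mat_diag (n + 1) (\<lambda>i. 1 / step b i)"
    using mat_inv_eqI[OF mat_diag_dim mat_diag_dim D] by (simp_all add: Dh_mat_def)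
qed

text \<open>Column \<open>j\<close> samples \<open>relu (x - b j)\<close> at the right end points
  \<open>b (i + 1)\<close> of the subintervals.\<close>

definition Q_inv :: "real mat" where
  "Q_inv = lower_ones n * Dh_mat n b * lower_ones n"

lemma Q_inv_carrier: "Q_inv \<in> carrier_mat (n + 1) (n + 1)"
  by (simp add: Q_inv_def Dh_mat_def)

lemma Q_carrier: "Q_mat n b \<in> carrier_mat (n + 1) (n + 1)"
  by (simp add: Q_mat_def Dh_inverse)

lemma G_Q_inv: "G_mat n * Q_inv = Dh_mat n b * lower_ones n"
  by (simp add: Q_inv_def Dh_mat_def assoc_mult_mat[of _ "n + 1" "n + 1" _ "n + 1" _ "n + 1"]
      cancel_left[OF G_mat_lower_ones])

lemma Q_Q_inv: "Q_mat n b * Q_inv = 1\<^sub>m (n + 1)"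
proof -
  let ?N = "n + 1"
  let ?Di = "mat_diag ?N (\<lambda>i. 1 / step b i)" and ?D = "mat_diag ?N (step b)"
  have "step b i \<noteq> 0" if "i < ?N" for i
    using b_step[of i] that by (simp add: step_def)
  note D = mat_diag_inverse(2)[of ?N "step b", OF this]
  have "Q_mat n b * Q_inv = G_mat n * (?Di * (G_mat n * Q_inv))"
    using Q_inv_carrier by (simp add: Q_mat_def Dh_inverse assoc_mult_mat[of _ ?N ?N _ ?N _ ?N])
  also have "\<dots> = G_mat n * (?Di * (?D * lower_ones n))" by (simp only: G_Q_inv Dh_mat_def)
  also have "\<dots> = G_mat n * lower_ones n"
    by (subst cancel_left[OF D]) (simp_all del: mat_diag_diag)
  finally show ?thesis by (simp add: G_mat_lower_ones)
qed

lemma Q_inverse: "invertible_mat (Q_mat n b)" "mat_inv (Q_mat n b) = Q_inv"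
  by (simp_all add: mat_inv_eqI[OF Q_carrier Q_inv_carrier Q_Q_inv])

lemma transpose_Q_inverse: "mat_inv (transpose_mat (Q_mat n b)) = transpose_mat Q_inv"
proof (rule mat_inv_eqI)
  have "Q_inv * Q_mat n b = 1\<^sub>m (n + 1)" by (rule mat_mult_left_right_inverse[OF Q_carrier Q_inv_carrier Q_Q_inv])
  then show "transpose_mat (Q_mat n b) * transpose_mat Q_inv = 1\<^sub>m (n + 1)"
    using transpose_mult[OF Q_inv_carrier Q_carrier] by simp
qed (use Q_carrier Q_inv_carrier in auto)

lemma banded_Q: "banded (-2) 0 (Q_mat n b)"
proof -
  have "banded ((-1 + 0) + -1) ((0 + 0) + 0) (Q_mat n b)"
    unfolding Q_mat_def Dh_inverse
    by (intro banded_mult banded_mat_diag banded_G_mat) (auto simp: G_mat_def mat_diag_def)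
  then show ?thesis by simp
qed

lemma G_Q_inv_index:
  assumes "i \<le> n" "j \<le> n"
  shows "(G_mat n * Q_inv) $$ (i, j) = (if j \<le> i then step b i else 0)"
  using assms unfolding G_Q_inv Dh_mat_def
  by (subst mat_diag_mult_left[OF lower_ones_carrier]) (simp add: lower_ones_def)

text \<open>The value at the right end point minus the increment is the value at the left end
  point.\<close>

lemma one_minus_G_Q_inv_index:
  assumes "i \<le> n" "j \<le> n"
  shows "((1\<^sub>m (n + 1) - G_mat n) * Q_inv) $$ (i, j) = relu (b i - b j)"
proof -
  have "(1\<^sub>m (n + 1) - G_mat n) * Q_inv = Q_inv - G_mat n * Q_inv"
    using Q_inv_carrier minus_mult_distrib_mat[OF one_carrier_mat[of "n + 1"] G_mat_carrier Q_inv_carrier] by simp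
  moreover have "Q_inv $$ (i, j) = (if j \<le> i then b (i + 1) - b j else 0)"
    using assms by (simp add: Q_inv_def Dh_mat_def lower_ones_diag_lower_ones_index sum_step
        del: One_nat_def) 
  moreover have "(Q_inv - G_mat n * Q_inv) $$ (i, j) = Q_inv $$ (i, j) - (G_mat n * Q_inv) $$ (i, j)"
    using assms by (intro index_minus_mat(1)) (simp_all add: G_Q_inv Dh_mat_def mat_diag_def lower_ones_def)
  ultimately show ?thesis
    using assms G_Q_inv_index[OF assms] b_mono[of i j] b_mono[of j i]
    by (auto simp: step_def relu_def max_def)
qed

section \<open>The matrix \<open>T\<close> and the second factorization\<close>

lemma T_mat_eq:
  defines "E \<equiv> 1\<^sub>m (n + 1) - G_mat n" and "h \<equiv> step b" and "s \<equiv> \<lambda>k. s_moment k r b"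
  shows "T_mat n r b = transpose_mat E * mat_diag (n + 1) (s 0) * E
    + transpose_mat E * mat_diag (n + 1) (\<lambda>i. s 1 i / h i) * G_mat n
    + transpose_mat (G_mat n) * mat_diag (n + 1) (\<lambda>i. s 1 i / h i) * E
    + transpose_mat (G_mat n) * mat_diag (n + 1) (\<lambda>i. s 2 i / (h i)\<^sup>2) * G_mat n"
proof -
  \<comment> \<open>This gives all four summands the same shape: a transpose, a diagonal matrix and
    a matrix, with outer factors among \<open>E\<close> and \<open>G_mat n\<close>.\<close>
  have "transpose_mat E = 1\<^sub>m (n + 1) - transpose_mat (G_mat n)"
    by (auto simp: E_def G_mat_def intro!: eq_matI)
  moreover have "mat_inv (Dh_mat n b) ^\<^sub>m 2 = mat_diag (n + 1) (\<lambda>i. 1 / (h i)\<^sup>2)"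
    by (simp add: Dh_inverse numeral_2_eq_2 h_def)
  ultimately show ?thesis
    by (simp add: T_mat_def Let_def D00_mat_def D01_mat_def D10_mat_def D11_mat_def Ds_mat_def
        Dh_inverse E_def h_def s_def)
qed

text \<open>In each summand the outer factors have the bands \<open>0..1\<close> and
  \<open>-1..0\<close>, which add up to \<open>-1..1\<close>.\<close>

lemma banded_T: "banded (-1) 1 (T_mat n r b)"
proof -
  define E where "E = 1\<^sub>m (n + 1) - G_mat n"
  have E: "banded (-1) 0 E"
    by (auto simp: banded_def E_def G_mat_def split: if_splits)
  have *: "banded (-1) 1 (transpose_mat X * mat_diag (n + 1) d * Y)"
    if "banded (-1) 0 X" "banded (-1) 0 Y" "X \<in> carrier_mat (n + 1) (n + 1)"
      "Y \<in> carrier_mat (n + 1) (n + 1)" for X Y :: "real mat" and d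
  proof -
    have "banded (0 + 0 + -1) (1 + 0 + 0) (transpose_mat X * mat_diag (n + 1) d * Y)"
      using that banded_transpose[of "-1" 0 X]
      by (intro banded_mult banded_mat_diag) (auto simp: mat_diag_def)
    then show ?thesis by simp
  qed
  show ?thesis unfolding T_mat_eq E_def[symmetric]
    by (intro banded_add *) (auto simp: E banded_G_mat, auto simp: E_def G_mat_def)
qed

lemma mass_mat_eq_T: "mass_mat n r b = transpose_mat Q_inv * T_mat n r b * Q_inv"
proof (rule eq_matI)
  let ?N = "n + 1"
  define E where "E = 1\<^sub>m ?N - G_mat n"
  define h where "h = step b"
  define s where "s = (\<lambda>k. s_moment k r b)"
  let ?G = "G_mat n" and ?QT = "transpose_mat Q_inv"
  define P where "P X d Y = transpose_mat X * mat_diag ?N d * Y" for X Y :: "real mat" and d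
  have P: "P X d Y \<in> carrier_mat ?N ?N" if "X \<in> carrier_mat ?N ?N" "Y \<in> carrier_mat ?N ?N" for X Y d
    using that by (simp add: P_def)
  have E: "E \<in> carrier_mat ?N ?N" by (simp add: E_def minus_carrier_mat)
  note cs = E G_mat_carrier[of n]
  have T: "T_mat n r b = P E (s 0) E + P E (\<lambda>i. s 1 i / h i) ?G + P ?G (\<lambda>i. s 1 i / h i) E
      + P ?G (\<lambda>i. s 2 i / (h i)\<^sup>2) ?G"
    by (simp only: T_mat_eq P_def E_def h_def s_def)
  have cong: "(?QT * P X d Y * Q_inv) $$ (i, j) = (\<Sum>k<?N. (X * Q_inv) $$ (k, i) * d k * (Y * Q_inv) $$ (k, j))"
    if "X \<in> carrier_mat ?N ?N" "Y \<in> carrier_mat ?N ?N" "i \<le> n" "j \<le> n" for X Y d i j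
    unfolding P_def using that Q_inv_carrier
    by (subst congruence_transpose_mult[of _ ?N]; (subst transpose_diag_mult_index)?)
      simp_all
  have dist: "(?QT * (A + B) * Q_inv) $$ (i, j) = (?QT * A * Q_inv) $$ (i, j) + (?QT * B * Q_inv) $$ (i, j)"
    if "A \<in> carrier_mat ?N ?N" "B \<in> carrier_mat ?N ?N" "i \<le> n" "j \<le> n" for A B i j
  proof -
    have QT: "?QT \<in> carrier_mat ?N ?N" using Q_inv_carrier by simp
    have "?QT * (A + B) * Q_inv = ?QT * A * Q_inv + ?QT * B * Q_inv"
      unfolding mult_add_distrib_mat[OF QT that(1,2)]
      by (rule add_mult_distrib_mat[OF _ _ Q_inv_carrier]; rule square_mult_carrier[OF QT]; fact)
    then show ?thesis using that Q_inv_carrier by simp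
  qed
  fix i j assume "i < dim_row (?QT * T_mat n r b * Q_inv)" "j < dim_col (?QT * T_mat n r b * Q_inv)"
  then have ij: "i \<le> n" "j \<le> n" using Q_inv_carrier by auto
  \<comment> \<open>On subinterval \<open>k\<close> the function \<open>relu (x - b j)\<close> has
    the value \<open>y k j\<close> at the left end point and the slope \<open>c k j\<close>.\<close>
  define y where "y k j = relu (b k - b j)" for k j :: nat
  define c where "c k j = (if j \<le> k then 1 else 0 :: real)" for k j :: nat
  have idx: "(E * Q_inv) $$ (k, j) = y k j" "(?G * Q_inv) $$ (k, j) = c k j * h k" if "k < ?N" "j \<le> n" for k j
    using that one_minus_G_Q_inv_index[of k j] G_Q_inv_index[of k j]
    by (simp_all add: y_def c_def E_def h_def)
  have h: "h k \<noteq> 0" if "k < ?N" for k using b_step[of k] that by (simp add: h_def step_def)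
  have "(?QT * T_mat n r b * Q_inv) $$ (i, j) =
      (\<Sum>k<?N. (E * Q_inv) $$ (k, i) * s 0 k * (E * Q_inv) $$ (k, j))
    + (\<Sum>k<?N. (E * Q_inv) $$ (k, i) * (s 1 k / h k) * (?G * Q_inv) $$ (k, j))
    + (\<Sum>k<?N. (?G * Q_inv) $$ (k, i) * (s 1 k / h k) * (E * Q_inv) $$ (k, j))
    + (\<Sum>k<?N. (?G * Q_inv) $$ (k, i) * (s 2 k / (h k)\<^sup>2) * (?G * Q_inv) $$ (k, j))"
    unfolding T by (simp only: dist cong P cs ij add_carrier_mat)
  \<comment> \<open>Each increment carries a factor \<open>h k\<close>, which cancels a denominator;
    the two middle sums share the first moment.\<close>
  also have "\<dots> = (\<Sum>k<?N. y k i * y k j * s 0 k + (y k i * c k j + c k i * y k j) * s 1 k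
      + c k i * c k j * s 2 k)"
    unfolding sum.distrib[symmetric]
    by (intro sum.cong refl) (simp add: idx ij h power2_eq_square field_simps del: One_nat_def)
  also have "\<dots> = (\<Sum>k<?N. LINT x:{b k<..<b (k + 1)}|lebesgue. r x * (relu (x - b i) * relu (x - b j)))"
  proof (intro sum.cong refl)
    fix k assume "k \<in> {..<?N}"
    then have k: "k \<le> n" by simp
    let ?I = "{b k<..<b (k + 1)}"
    have sub: "?I \<subseteq> {0<..<1}" using b_nonneg[of k] b_le_1[of "k + 1"] k by auto
    \<comment> \<open>No breakpoint lies inside the subinterval, so there is no kink.\<close>
    have loc: "relu (x - b j) = y k j + c k j * (x - b k)" if "x \<in> ?I" "j \<le> n" for x j
    proof (cases "j \<le> k")
      case True
      then show ?thesis using that k b_mono[of j k] by (simp add: y_def c_def relu_simps)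
    next
      case False
      then show ?thesis using that k b_mono[of "k + 1" j] by (simp add: y_def c_def relu_simps)
    qed
    \<comment> \<open>Expansion in powers of \<open>x - b k\<close>; the exponents 0 and 1 stay
      explicit so that the integrals are the moments.\<close>
    have "(LINT x:?I|lebesgue. r x * (relu (x - b i) * relu (x - b j)))
       = (LINT x:?I|lebesgue. y k i * y k j * (r x * (x - b k) ^ 0)
         + (y k i * c k j + c k i * y k j) * (r x * (x - b k) ^ 1) + c k i * c k j * (r x * (x - b k) ^ 2))"
      by (intro set_lebesgue_integral_cong)
        (auto simp: loc ij power2_eq_square algebra_simps)
    also have "\<dots> = y k i * y k j * s 0 k + (y k i * c k j + c k i * y k j) * s 1 k
        + c k i * c k j * s 2 k"
      unfolding s_def s_moment_def
      using Linfty01_integrable[OF r _ _ sub, of "\<lambda>x. (x - b k) ^ 0"]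
        Linfty01_integrable[OF r _ _ sub, of "\<lambda>x. (x - b k) ^ 1"]
        Linfty01_integrable[OF r _ _ sub, of "\<lambda>x. (x - b k) ^ 2"]
      by (subst set_integral_add, simp_all add: continuous_intros set_integral_add
         del: power_0 power_one_right)
    finally show "y k i * y k j * s 0 k + (y k i * c k j + c k i * y k j) * s 1 k
        + c k i * c k j * s 2 k = (LINT x:?I|lebesgue. r x * (relu (x - b i) * relu (x - b j)))" ..
  qed
  also have "\<dots> = J (\<lambda>x. relu (x - b i) * relu (x - b j))"
    unfolding weighted_integral_def
    by (rule set_integral_partition[symmetric])
      (auto intro!: Linfty01_integrable[OF r] continuous_intros)
  finally show "mass_mat n r b $$ (i, j) = (?QT * T_mat n r b * Q_inv) $$ (i, j)"
    using ij by (simp add: mass_mat_index)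
qed (use Q_inv_carrier in \<open>auto simp: mass_mat_def\<close>)

section \<open>Invertibility of the mass matrix for a positive lower bound\<close>

lemma mass_mat_invertible:
  assumes r0: "r0 > 0" "AE x in lebesgue_on {0<..<1}. r0 \<le> r x"
  shows "invertible_mat (mass_mat n r b)"
proof -
  let ?M = "mass_mat n r b" and ?N = "n + 1"
  have M: "?M \<in> carrier_mat ?N ?N" by (simp add: mass_mat_def)
  have "det ?M \<noteq> 0"
  proof
    assume "det ?M = 0"
    then obtain v where v: "v \<in> carrier_vec ?N" "v \<noteq> 0\<^sub>v ?N" and Mv: "?M *\<^sub>v v = 0\<^sub>v ?N"
      using det_0_iff_vec_prod_zero[OF M] by auto
    define f where "f x = (\<Sum>i<?N. v $ i * relu (x - b i))" for x
    have f_cont: "continuous_on UNIV f"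
      unfolding f_def by (intro continuous_intros)
    \<comment> \<open>The free factor \<open>y\<close> is \<open>relu (x - b i)\<close> in the rows
      of the kernel equation and \<open>f x\<close> in the quadratic form.\<close>
    have f_mult: "(\<Sum>j<?N. v $ j * (y * relu (x - b j))) = y * f x" for x y
      unfolding f_def sum_distrib_left by (intro sum.cong) simp_all
    have "J (\<lambda>x. relu (x - b i) * f x) = 0" if i: "i < ?N" for i
    proof -
      have "0 = (?M *\<^sub>v v) $ i" using Mv i by simp
      also have "\<dots> = (\<Sum>j<?N. ?M $$ (i, j) * v $ j)"
        using i M v by (auto simp: scalar_prod_def lessThan_atLeast0 intro!: sum.cong)
      also have "\<dots> = (\<Sum>j<?N. J (\<lambda>x. v $ j * (relu (x - b i) * relu (x - b j))))"
        using i by (intro sum.cong) (auto simp: mass_mat_index J_cmult)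
      also have "\<dots> = J (\<lambda>x. \<Sum>j<?N. v $ j * (relu (x - b i) * relu (x - b j)))"
        by (rule J_sum[symmetric]) (auto intro!: continuous_intros)
      finally show ?thesis unfolding f_mult by simp
    qed
    \<comment> \<open>Weighting row \<open>i\<close> by \<open>v $ i\<close> and summing gives the
      quadratic form of \<open>v\<close>.\<close>
    then have "0 = (\<Sum>i<?N. J (\<lambda>x. v $ i * (f x * relu (x - b i))))"
      by (simp add: J_cmult mult.commute del: sum.lessThan_Suc)
    also have "\<dots> = J (\<lambda>x. \<Sum>i<?N. v $ i * (f x * relu (x - b i)))"
      by (rule J_sum[symmetric]) (auto intro!: continuous_intros f_cont)
    finally have J0: "J (\<lambda>x. (f x)\<^sup>2) = 0" unfolding f_mult by (simp add: power2_eq_square)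
    have "\<exists>k. k < ?N \<and> v $ k \<noteq> 0"
    proof (rule ccontr)
      assume "\<not> ?thesis"
      then have "v = 0\<^sub>v ?N" using v(1) by (intro eq_vecI) auto
      with v(2) show False ..
    qed
    \<comment> \<open>Minimality removes the terms before \<open>k\<close>, and those after
      \<open>k\<close> vanish on the subinterval, so \<open>f\<close> is a single linear piece
      there.\<close>
    then obtain k where k: "k < ?N" "v $ k \<noteq> 0" and "\<forall>i<k. \<not> (i < ?N \<and> v $ i \<noteq> 0)"
      unfolding exists_least_iff[of "\<lambda>k. k < ?N \<and> v $ k \<noteq> 0"] by blast
    then have least: "v $ i = 0" if "i < k" for i using that by auto
    have f: "f x = v $ k * (x - b k)" if x: "b k < x" "x < b (k + 1)" for x
    proof -
      have "f x = (\<Sum>i<?N. if i = k then v $ k * (x - b k) else 0)"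
        unfolding f_def
      proof (intro sum.cong refl)
        fix i assume "i \<in> {..<?N}"
        then show "v $ i * relu (x - b i) = (if i = k then v $ k * (x - b k) else 0)"
          using x least[of i] b_mono[of "k + 1" i]
          by (cases i k rule: linorder_cases) (auto simp: relu_simps)
      qed
      with k show ?thesis by simp
    qed
    have sub: "{b k<..<b (k + 1)} \<subseteq> {0<..<1}"
      using b_nonneg[of k] b_le_1[of "k + 1"] k by auto
    \<comment> \<open>Otherwise \<open>r0 > 0\<close> would make this interval of positive length a
      null set.\<close>
    have "\<not> (AE x in lebesgue_on {b k<..<b (k + 1)}. r x = 0)"
    proof
      assume "AE x in lebesgue_on {b k<..<b (k + 1)}. r x = 0"
      then have "AE x in lebesgue. x \<in> {b k<..<b (k + 1)} \<longrightarrow> r x = 0"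
        by (simp add: AE_restrict_space_iff)
      moreover have "AE x in lebesgue. x \<in> {0<..<1} \<longrightarrow> r0 \<le> r x"
        using r0(2) by (simp add: AE_restrict_space_iff)
      ultimately have "AE x in lebesgue. x \<notin> {b k<..<b (k + 1)}"
      proof eventually_elim
        case (elim x)
        then show ?case using sub r0(1) by auto
      qed
      then have "emeasure lebesgue {b k<..<b (k + 1)} = 0"
        by (subst (asm) AE_iff_measurable[of "{b k<..<b (k + 1)}"]) auto
      then show False using b_step[of k] k by simp
    qed
    then have "0 < J (\<lambda>x. (f x)\<^sup>2)"
      by (intro J_pos[OF _ _ sub]) (auto simp: f k(2) intro!: continuous_intros f_cont)
    with J0 show False by simp
  qed
  then show ?thesis
    using det_non_zero_imp_unit[OF M, where b = "()"] M
    by (auto simp: Units_def ring_mat_def invertible_mat_def inverts_mat_def)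
qed

end

section \<open>The two factorizations and the formula for the inverse\<close>

theorem lemma4p5:
  fixes n :: nat and b :: "nat \<Rightarrow> real" and r :: "real \<Rightarrow> real" and r0 :: real
  assumes "n \<ge> 1"
    and "b 0 = 0" and "b (n + 1) = 1" and "\<And>i. i \<le> n \<Longrightarrow> b i < b (i + 1)"
    and "Linfty01 r"
    and "r0 \<ge> 0" and "AE x in lebesgue_on {0<..<1}. r0 \<le> r x"
  defines "M \<equiv> mass_mat n r b"
    and "M1 \<equiv> M1_mat n r b" and "M2 \<equiv> M2_mat n r b"
    and "Q \<equiv> Q_mat n b" and "T \<equiv> T_mat n r b"
  shows "(invertible_mat M1 \<longleftrightarrow> nonvanishing_last n r b)
    \<and> (invertible_mat M2 \<longleftrightarrow> nonvanishing_last n r b)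
    \<and> (nonvanishing_last n r b \<longrightarrow>
         (let T1 = mat_inv M1; T2 = mat_inv M2 + mat_inv M1; T3 = mat_inv M2
          in tridiagonal T1 \<and> tridiagonal T2 \<and> tridiagonal T3
             \<and> M = mat_inv T1 * T2 * mat_inv T3))
    \<and> (invertible_mat M \<longrightarrow>
         nonvanishing_last n r b
         \<and> invertible_mat (mat_inv M2 + mat_inv M1)
         \<and> mat_inv M = mat_inv M2 * mat_inv (mat_inv M2 + mat_inv M1) * mat_inv M1)
    \<and> (r0 > 0 \<longrightarrow> invertible_mat M)
    \<and> invertible_mat (Dh_mat n b) \<and> invertible_mat Q
    \<and> (let T1 = transpose_mat Q; T2 = T; T3 = Q
       in tridiagonal T1 \<and> tridiagonal T2 \<and> tridiagonal T3
          \<and> M = mat_inv T1 * T2 * mat_inv T3)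
    \<and> M = transpose_mat (mat_inv Q) * T * mat_inv Q"
proof -
  interpret weighted_breakpoints n b r
  proof
    show "AE x in lebesgue_on {0<..<1}. 0 \<le> r x"
      using assms(7) by eventually_elim (use assms(6) in simp)
  qed (fact assms)+
  let ?N = "n + 1"
  have cM: "M \<in> carrier_mat ?N ?N" "M1 \<in> carrier_mat ?N ?N" "M2 \<in> carrier_mat ?N ?N"
    by (simp_all add: M_def M1_def M2_def mass_mat_def M1_mat_def M2_mat_def)
  note as = assoc_mult_mat[of _ ?N ?N _ ?N _ ?N]
  have iff: "invertible_mat M1 \<longleftrightarrow> nonvanishing_last n r b" "invertible_mat M2 \<longleftrightarrow> nonvanishing_last n r b"
    unfolding M1_def M2_def using M1_inverse(1) M2_inverse(1) vanishing_last by blast+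
  have last: "nonvanishing_last n r b" if "invertible_mat M"
    using that vanishing_last(3) by (auto simp: M_def)
  \<comment> \<open>Distributing the outer factors over the sum leaves
    \<open>M1 + M2\<close>.\<close>
  have fact1: "M = M1 * (mat_inv M2 + mat_inv M1) * M2" if "nonvanishing_last n r b"
  proof -
    have "invertible_mat M1" "invertible_mat M2" using that iff by auto
    note i1 = invertible_mat_inv[OF cM(2) this(1)] and i2 = invertible_mat_inv[OF cM(3) this(2)]
    have "M1 * (mat_inv M2 + mat_inv M1) * M2 = M1 * (mat_inv M2 * M2) + (M1 * mat_inv M1) * M2"
      using i1(1) i2(1) cM
      by (simp add: mult_add_distrib_mat[of M1 ?N ?N _ ?N] add_mult_distrib_mat[of _ ?N ?N _ _ ?N] as)
    also have "\<dots> = M" using cM by (simp add: i1 i2) (simp add: M_def M1_def M2_def mass_mat_eq_sum)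
    finally show ?thesis ..
  qed
  have part1: "tridiagonal (mat_inv M1) \<and> tridiagonal (mat_inv M2 + mat_inv M1) \<and> tridiagonal (mat_inv M2)
     \<and> M = mat_inv (mat_inv M1) * (mat_inv M2 + mat_inv M1) * mat_inv (mat_inv M2)"
    if nz: "nonvanishing_last n r b"
  proof -
    have "invertible_mat M1" "invertible_mat M2" using nz iff by auto
    note i1 = invertible_mat_inv[OF cM(2) this(1)] and i2 = invertible_mat_inv[OF cM(3) this(2)]
    have B: "banded (-1) 1 (mat_inv M1)" "banded (-1) 1 (mat_inv M2)"
      using M1_inverse(2)[OF nz] M2_inverse(2)[OF nz] by (simp_all add: M1_def M2_def)
    moreover have "banded (-1) 1 (mat_inv M2 + mat_inv M1)"
      using i1(1) i2(1) by (intro banded_add B) auto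
    ultimately show ?thesis using fact1[OF nz] by (simp add: i1 i2 banded_tridiagonal[of "-1" 1])
  qed
  have part2: "invertible_mat (mat_inv M2 + mat_inv M1)
      \<and> mat_inv M = mat_inv M2 * mat_inv (mat_inv M2 + mat_inv M1) * mat_inv M1"
    if inv: "invertible_mat M"
  proof -
    let ?S = "mat_inv M2 + mat_inv M1"
    have nz: "nonvanishing_last n r b" by (rule last[OF inv])
    then have "invertible_mat M1" "invertible_mat M2" using iff by auto
    note i1 = invertible_mat_inv[OF cM(2) this(1)] and i2 = invertible_mat_inv[OF cM(3) this(2)]
    note iM = invertible_mat_inv[OF cM(1) inv]
    note mc = square_mult_carrier
    have S: "?S \<in> carrier_mat ?N ?N" using i1(1) i2(1) by simp
    have M: "M = M1 * (?S * M2)" using fact1[OF nz] S cM by (simp add: as)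
    have SM: "?S * (M2 * mat_inv M) \<in> carrier_mat ?N ?N" using S cM iM(1) by (intro mc)
    have "M1 * (?S * (M2 * mat_inv M)) = M * mat_inv M"
      unfolding arg_cong[OF M, of "\<lambda>X. X * mat_inv M"]
      using S cM iM(1) by (simp only: as mc)
    then have "M1 * (?S * (M2 * mat_inv M)) = 1\<^sub>m ?N" by (simp add: iM(2))
    \<comment> \<open>The right inverse of \<open>M1\<close> is also a left inverse, so
      \<open>M1\<close> moves to the far right and \<open>M2 * mat_inv M * M1\<close> is an inverse
      of \<open>?S\<close>.\<close>
    from mat_mult_left_right_inverse[OF cM(2) SM this]
    have SX: "?S * (M2 * mat_inv M * M1) = 1\<^sub>m ?N"
      using S cM iM(1) by (simp only: as mc)
    have X: "M2 * mat_inv M * M1 \<in> carrier_mat ?N ?N" using cM iM(1) by (auto intro!: mc)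
    note Si = mat_inv_eqI[OF S X SX]
    have "mat_inv M2 * mat_inv ?S * mat_inv M1 = (mat_inv M2 * M2) * mat_inv M * (M1 * mat_inv M1)"
      unfolding Si(1) using S cM iM(1) i1(1) i2(1) by (simp only: as mc)
    also have "\<dots> = mat_inv M" using iM(1) by (simp add: i1 i2)
    finally show ?thesis using Si(2) by simp
  qed
  \<comment> \<open>Transposition turns the band \<open>-2..0\<close> of \<open>Q\<close> into
    \<open>0..2\<close>; both have three diagonals but are not centred.\<close>
  have "banded 0 2 (transpose_mat Q)" using banded_transpose[OF banded_Q] by (simp add: Q_def)
  then have part3: "tridiagonal (transpose_mat Q) \<and> tridiagonal T \<and> tridiagonal Q"
    using banded_Q banded_T by (auto simp: Q_def T_def intro: banded_tridiagonal)
  have inv: "mat_inv Q = Q_inv" "mat_inv (transpose_mat Q) = transpose_mat Q_inv" "invertible_mat Q"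
    by (simp_all add: Q_def Q_inverse transpose_Q_inverse)
  have part4: "M = transpose_mat Q_inv * T * Q_inv" unfolding M_def T_def by (rule mass_mat_eq_T)
  have part5: "invertible_mat M" if "r0 > 0"
    unfolding M_def by (rule mass_mat_invertible[OF that assms(7)])
  show ?thesis
    unfolding Let_def inv(1,2) using iff part1 last part2 part3 part4 part5 Dh_inverse(1) inv(3) by blast
qed

end
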